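(* Let $m\geq1$, let $k=\lceil m/2\rceil$ and let $[\alpha_1\cdots\alpha_k]^T$ be the solution to $[C^*_m(1)\ \cdots\ C^*_m(k)]\,[\alpha_1\cdots\alpha_k]^T=C^*_m(k+1)$ inside the $m\times\infty$ table. The recurrence relations $$\mathcal{C}(n+k,i)=\alpha_1\mathcal{C}(n,i)+\cdots+\alpha_k\mathcal{C}(n+k-1,i)\qquad(1\leq i\leq m,\ n\geq1)$$ and $$\mathcal{I}_m(n+k)=\alpha_1\mathcal{I}_m(n)+\cdots+\alpha_k\mathcal{I}_m(n+k-1)\qquad(n\geq1)$$ are given by any of the formulas $$\det((\Delta+1)I-\mathcal{T}^*_m)\,\mathcal{C}(n,i)=0\quad\text{or}\quad\mathcal{M}_m(k)\,\mathcal{C}(n,i)=0$$ and $$\det((\Delta+1)I-\mathcal{T}^*_m)\,\mathcal{I}_m(n)=0\quad\text{or}\quad\mathcal{M}_m(k)\,\mathcal{I}_m(n)=0,$$ respectively, for all $i=1,\ldots,m$ and $n\geq1$.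
   Context: Table: for an integer $m\geq1$, define $\mathcal{C}(x,y)=\mathcal{C}_m(x,y)$ for $x\geq1$, $1\leq y\leq m$, as the number of lattice paths (sequences of cells of the $m\times\infty$ table with steps in $\{(1,-1),(1,0),(1,1)\}$, first coordinate being the column) from any cell of the first column to the cell $(x,y)$. Equivalently, $\mathcal{C}(1,y)=1$ and $\mathcal{C}(x+1,y)=\mathcal{C}(x,y-1)+\mathcal{C}(x,y)+\mathcal{C}(x,y+1)$, with $\mathcal{C}(x,0)=\mathcal{C}(x,m+1)=0$. The $n$th column sum is $\mathcal{I}_m(n)=\mathcal{C}(n,1)+\cdots+\mathcal{C}(n,m)$, and the reduced $n$th column is $C^*_m(n)=[\mathcal{C}(n,1),\ldots,\mathcal{C}(n,\lceil m/2\rceil)]^T$. Reduced matrix: for $k\geq1$ let $\mathcal{O}_k$ and $\mathcal{E}_k$ be the following $k\times k$ tridiagonal matrices. $\mathcal{O}_1=[1]$, $\mathcal{E}_1=[2]$. For $k\geq2$, $\mathcal{O}_k$ has all diagonal, superdiagonal and subdiagonal entries equal to $1$, except that the $(k,k-1)$ entry is $2$; and $\mathcal{E}_k$ has all diagonal, superdiagonal and subdiagonal entries equal to $1$, except that the $(k,k)$ entry is $2$. Put $\mathcal{T}^*_m=\mathcal{O}_{\lceil m/2\rceil}$ if $m$ is odd and $\mathcal{T}^*_m=\mathcal{E}_{\lceil m/2\rceil}$ if $m$ is even. Multipliers: $\Delta$ is the difference operator, $\Delta a(n)=a(n+1)-a(n)$ for a sequence $\{a(n)\}$, so $\Delta+1$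 is the shift operator. $\mathcal{M}_m(n)$, $n\geq0$, are polynomials in $\Delta$ defined by $\mathcal{M}_m(0)=2$ if $m$ is odd and $\mathcal{M}_m(0)=1$ if $m$ is even, $\mathcal{M}_m(1)=\Delta-2+\mathcal{M}_m(0)$, and $\mathcal{M}_m(n+2)=\Delta\mathcal{M}_m(n+1)-\mathcal{M}_m(n)$ for all $n\geq0$. Polynomials in $\Delta$ act on $\mathcal{C}(n,i)$ with respect to the variable $n$ (with $i$ fixed), i.e. $\Delta\mathcal{C}(n,i)=\mathcal{C}(n+1,i)-\mathcal{C}(n,i)$, and on $\mathcal{I}_m(n)$ with respect to $n$. *)

theory Defs
  imports Complex_Main "Jordan_Normal_Form.Determinant"
begin

text \<open>Cells are (column, row) pairs of integers.\<close>

definition cells :: "nat \<Rightarrow> (int \<times> int) set" where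
  "cells m = {(x, y). 1 \<le> x \<and> 1 \<le> y \<and> y \<le> int m}"

definition steps :: "(int \<times> int) set" where
  "steps = {(1, -1), (1, 0), (1, 1)}"

definition lattice_path :: "nat \<Rightarrow> (int \<times> int) list \<Rightarrow> bool" where
  "lattice_path m ps \<longleftrightarrow> ps \<noteq> [] \<and> set ps \<subseteq> cells m \<and>
     successively (\<lambda>(x, y) (x', y'). (x' - x, y' - y) \<in> steps) ps"

definition table :: "nat \<Rightarrow> nat \<Rightarrow> nat \<Rightarrow> nat" where
  "table m x y = card {ps. lattice_path m ps \<and> fst (hd ps) = 1 \<and> last ps = (int x, int y)}"

definition column_sum :: "nat \<Rightarrow> nat \<Rightarrow> nat" where
  "column_sum m n = (\<Sum>y = 1..m. table m n y)"

abbreviation half :: "nat \<Rightarrow> nat" where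
  "half m \<equiv> nat \<lceil>real m / 2\<rceil>"

text \<open>Vectors and matrices are indexed from 0, so entry \<open>i\<close> below is the table entry in row
  \<open>i + 1\<close>.\<close>

definition reduced_column :: "nat \<Rightarrow> nat \<Rightarrow> real vec" where
  "reduced_column m n = vec (half m) (\<lambda>i. real (table m n (i + 1)))"

definition reduced_columns :: "nat \<Rightarrow> real mat" where
  "reduced_columns m = mat_of_cols (half m) (map (reduced_column m) [1..<half m + 1])"

definition column_solution :: "nat \<Rightarrow> real vec \<Rightarrow> bool" where
  "column_solution m \<alpha> \<longleftrightarrow> \<alpha> \<in> carrier_vec (half m) \<and>
     reduced_columns m *\<^sub>v \<alpha> = reduced_column m (half m + 1)"

text \<open>The exceptional entry of \<open>odd_matrix k\<close> lies in row \<open>k\<close>, column \<open>k - 1\<close> (counted from 1) and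
  is absent for \<open>k = 1\<close>; that of \<open>even_matrix k\<close> is the last diagonal entry.\<close>

definition odd_matrix :: "nat \<Rightarrow> real mat" where
  "odd_matrix k = mat k k (\<lambda>(i, j).
     if i + 1 = k \<and> j + 2 = k then 2
     else if i = j \<or> i = j + 1 \<or> j = i + 1 then 1 else 0)"

definition even_matrix :: "nat \<Rightarrow> real mat" where
  "even_matrix k = mat k k (\<lambda>(i, j).
     if i + 1 = k \<and> j + 1 = k then 2
     else if i = j \<or> i = j + 1 \<or> j = i + 1 then 1 else 0)"

definition reduced_matrix :: "nat \<Rightarrow> real mat" where
  "reduced_matrix m = (if odd m then odd_matrix (half m) else even_matrix (half m))"

text \<open>Polynomials in the difference operator are formal polynomials whose indeterminate
  \<open>[:0, 1:]\<close> stands for \<open>\<Delta>\<close>; \<open>apply_poly\<close> lets them act on sequences.\<close>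

definition difference :: "(nat \<Rightarrow> real) \<Rightarrow> nat \<Rightarrow> real" where
  "difference a n = a (n + 1) - a n"

definition apply_poly :: "real poly \<Rightarrow> (nat \<Rightarrow> real) \<Rightarrow> nat \<Rightarrow> real" where
  "apply_poly p a n = (\<Sum>i\<le>degree p. coeff p i * (difference ^^ i) a n)"

text \<open>\<open>det ((\<Delta> + 1) I - T)\<close> for the reduced matrix \<open>T\<close>, with \<open>[:1, 1:] = \<Delta> + 1\<close>.\<close>

definition det_poly :: "nat \<Rightarrow> real poly" where
  "det_poly m =
     det ([:1, 1:] \<cdot>\<^sub>m 1\<^sub>m (half m) - map_mat (\<lambda>c. [:c:]) (reduced_matrix m))"

fun multiplier :: "nat \<Rightarrow> nat \<Rightarrow> real poly" where
  "multiplier m 0 = (if odd m then 2 else 1)"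
| "multiplier m (Suc 0) = [:0, 1:] - 2 + multiplier m 0"
| "multiplier m (Suc (Suc n)) = [:0, 1:] * multiplier m (Suc n) - multiplier m n"

end

theory Submission imports Defs begin

text \<open>
  Write \<open>k = \<lceil>m/2\<rceil>\<close> and let \<open>C(n, i)\<close> be the table.  Removing the last cell of a path gives
  \<open>\<Delta> C(n, i) = C(n, i - 1) + C(n, i + 1)\<close>, with \<open>C\<close> vanishing in the rows \<open>0\<close> and \<open>m + 1\<close>, and the
  table is symmetric under \<open>i \<mapsto> m + 1 - i\<close>.

  \<^emph>\<open>The multiplier annihilates the table.\<close>  The recursion of the multipliers is the row recurrence
  solved for the row above, so the multiplier \<open>M(j)\<close> carries the middle row \<open>C(n, k)\<close> to
  \<open>e C(n, k - j)\<close>, where \<open>e = 2\<close> for odd \<open>m\<close> and \<open>e = 1\<close> for even \<open>m\<close>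
  (\<open>multiplier_middle_row\<close>).  At \<open>j = k\<close> this is the zero row \<open>0\<close>.  As polynomials in \<open>\<Delta>\<close>
  commute and every upper row is a multiple of some \<open>M(j) C(n, k)\<close>, the multiplier \<open>M(k)\<close>
  annihilates all upper rows and, by symmetry, all rows (\<open>multiplier_annihilates_table\<close>).

  \<^emph>\<open>The determinant is the multiplier.\<close>  Laplace expansion of the tridiagonal determinant along its
  first row and column is the three-term recursion of the multipliers (\<open>det_char_matrix\<close>).

  \<^emph>\<open>The coefficients are the solution of the linear system.\<close>  The polynomial \<open>M(k)\<close> is monic of
  degree \<open>k\<close>, so in terms of the shift \<open>\<Delta> + 1\<close> it is a recurrence of order \<open>k\<close>, and its
  coefficients solve the system.  They are the only solution because the first \<open>k\<close> reduced columns
  are linearly independent (\<open>columns_independent\<close>): a relation among them would hold along the whole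
  middle row, but this row starts with \<open>1, 3, \<dots>, 3\<^sup>k\<^sup>-\<^sup>1\<close> and continues with a number below
  \<open>3\<^sup>k\<close>.
\<close>

lemma half_eq: "half m = (m + 1) div 2"
proof (cases "even m")
  case True
  then obtain l where "m = 2 * l" by blast
  then show ?thesis by simp
next
  case False
  then obtain l where l: "m = 2 * l + 1" by (rule oddE)
  have "\<lceil>real m / 2\<rceil> = int l + 1"
    by (rule ceiling_unique) (auto simp: l field_simps)
  then show ?thesis by (simp add: l nat_add_distrib)
qed

section \<open>The recurrence and the symmetry of the table\<close>

text \<open>The paths counted by the table, with the end cell \<open>(x, y)\<close> allowed to be any pair of integers, so
  that predecessors outside the table need no special treatment.\<close>

definition paths :: "nat \<Rightarrow> int \<Rightarrow> int \<Rightarrow> (int \<times> int) list set" where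
  "paths m x y = {ps. lattice_path m ps \<and> fst (hd ps) = 1 \<and> last ps = (x, y)}"

lemma table_eq_card_paths: "table m x y = card (paths m (int x) (int y))"
  by (simp add: table_def paths_def)

lemma lattice_path_snoc:
  "lattice_path m (qs @ [(x, y)]) \<longleftrightarrow> (x, y) \<in> cells m \<and>
     (qs = [] \<or> lattice_path m qs \<and> (x - fst (last qs), y - snd (last qs)) \<in> steps)"
  by (auto simp: lattice_path_def successively_append_iff case_prod_unfold)

lemma paths_outside: "(x, y) \<notin> cells m \<Longrightarrow> paths m x y = {}"
  unfolding paths_def lattice_path_def using last_in_set by fastforce

lemma paths_first_column:
  assumes "1 \<le> y" "y \<le> int m"
  shows "paths m 1 y = {[(1, y)]}"
proof -
  have "ps = [(1, y)]" if ps: "ps \<in> paths m 1 y" for ps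
  proof (cases ps rule: rev_cases)
    case Nil
    then show ?thesis using ps by (simp add: paths_def lattice_path_def)
  next
    case (snoc qs p)
    then have p: "p = (1, y)" using ps by (simp add: paths_def)
    have "qs = []"
    proof (rule ccontr)
      assume "qs \<noteq> []"
      then have "lattice_path m qs" "(1 - fst (last qs), y - snd (last qs)) \<in> steps"
        using ps unfolding paths_def snoc p by (auto simp: lattice_path_snoc)
      then have "fst (last qs) = 0" "last qs \<in> cells m"
        by (auto simp: steps_def lattice_path_def)
      then show False by (auto simp: cells_def)
    qed
    then show ?thesis by (simp add: snoc p)
  qed
  moreover have "[(1, y)] \<in> paths m 1 y"
    using assms by (auto simp: paths_def lattice_path_def cells_def)
  ultimately show ?thesis by blast
qed

lemma paths_next_column:
  assumes "1 \<le> x" "1 \<le> y" "y \<le> int m"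
  shows "paths m (x + 1) y =
    (\<lambda>qs. qs @ [(x + 1, y)]) ` (paths m x (y - 1) \<union> paths m x y \<union> paths m x (y + 1))"
    (is "_ = ?f ` ?Q")
proof (intro equalityI subsetI)
  fix ps assume ps: "ps \<in> paths m (x + 1) y"
  show "ps \<in> ?f ` ?Q"
  proof (cases ps rule: rev_cases)
    case Nil
    then show ?thesis using ps by (simp add: paths_def lattice_path_def)
  next
    case (snoc qs p)
    then have p: "p = (x + 1, y)" using ps by (simp add: paths_def)
    have "qs \<noteq> []"
      using ps assms(1) unfolding snoc p by (auto simp: paths_def)
    then have qs: "lattice_path m qs" "(x + 1 - fst (last qs), y - snd (last qs)) \<in> steps"
      "fst (hd qs) = 1"
      using ps unfolding paths_def snoc p by (auto simp: lattice_path_snoc)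
    obtain a b where ab: "last qs = (a, b)" by (cases "last qs")
    have "a = x \<and> (b = y - 1 \<or> b = y \<or> b = y + 1)"
      using qs(2) by (auto simp: ab steps_def)
    then have "qs \<in> ?Q" using qs ab by (auto simp: paths_def)
    then show ?thesis by (simp add: snoc p)
  qed
next
  fix ps assume "ps \<in> ?f ` ?Q"
  then obtain qs where ps: "ps = qs @ [(x + 1, y)]" and qs: "qs \<in> ?Q" by blast
  have "qs \<noteq> []" using qs by (auto simp: paths_def lattice_path_def)
  then show "ps \<in> paths m (x + 1) y"
    using qs assms unfolding ps
    by (auto simp: paths_def lattice_path_snoc cells_def steps_def)
qed

lemma finite_paths: "finite (paths m (int x) y)"
proof (induction x arbitrary: y)
  case 0
  then show ?case by (simp add: paths_outside cells_def)
next
  case (Suc x)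
  consider "y < 1 \<or> int m < y" | "x = 0" "1 \<le> y" "y \<le> int m" | "1 \<le> x" "1 \<le> y" "y \<le> int m"
    by linarith
  then show ?case
  proof cases
    case 1
    then show ?thesis by (auto simp: paths_outside cells_def)
  next
    case 2
    then show ?thesis by (simp add: paths_first_column)
  next
    case 3
    then show ?thesis
      using paths_next_column[of "int x" y m] Suc.IH by (simp add: add.commute)
  qed
qed

lemma table_top [simp]: "table m x 0 = 0"
  by (simp add: table_eq_card_paths paths_outside cells_def)

lemma table_bottom [simp]: "table m x (Suc m) = 0"
  by (simp add: table_eq_card_paths paths_outside cells_def)

lemma table_first_column: "1 \<le> y \<Longrightarrow> y \<le> m \<Longrightarrow> table m 1 y = 1"
  by (simp add: table_eq_card_paths paths_first_column)

lemma table_next_column: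
  assumes "1 \<le> x" "1 \<le> y" "y \<le> m"
  shows "table m (Suc x) y = table m x (y - 1) + table m x y + table m x (y + 1)"
proof -
  let ?P = "paths m (int x)"
  have disj: "?P a \<inter> ?P b = {}" if "a \<noteq> b" for a b
    using that by (auto simp: paths_def)
  have "table m (Suc x) y = card (?P (int y - 1) \<union> ?P (int y) \<union> ?P (int y + 1))"
    using paths_next_column[of "int x" "int y" m] assms
    by (simp add: table_eq_card_paths add.commute card_image inj_on_def)
  also have "\<dots> = card (?P (int y - 1)) + card (?P (int y)) + card (?P (int y + 1))"
    by (simp add: card_Un_disjoint finite_paths disj Int_Un_distrib2)
  finally show ?thesis
    using assms by (simp add: table_eq_card_paths of_nat_diff add.commute)
qed

lemma table_symmetric:
  assumes "1 \<le> x" "y \<le> m + 1"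
  shows "table m x (m + 1 - y) = table m x y"
  using assms
proof (induction x arbitrary: y rule: dec_induct)
  case base
  consider "y = 0" | "y = m + 1" | "1 \<le> y" "y \<le> m" using base by linarith
  then show ?case
  proof cases
    case 3
    then have "1 \<le> m + 1 - y" "m + 1 - y \<le> m" by auto
    then show ?thesis using 3 table_first_column by metis
  qed auto
next
  case (step x)
  consider "y = 0" | "y = m + 1" | "1 \<le> y" "y \<le> m" using step.prems by linarith
  then show ?case
  proof cases
    case 3
    have "m + 1 - y - 1 = m + 1 - (y + 1)" "m + 1 - y + 1 = m + 1 - (y - 1)"
      using 3 by auto
    then show ?thesis
      using 3 step.IH[of "y - 1"] step.IH[of y] step.IH[of "y + 1"] step.hyps
      by (simp add: table_next_column)
  qed auto
qed

section \<open>Linear independence of the first reduced columns\<close>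

lemma table_le: "1 \<le> x \<Longrightarrow> y \<le> m + 1 \<Longrightarrow> table m x y \<le> 3 ^ (x - 1)"
proof (induction x arbitrary: y rule: dec_induct)
  case base
  then show ?case using table_first_column[of y m]
    by (cases "y = 0 \<or> y = Suc m") auto
next
  case (step x)
  show ?case
  proof (cases "y = 0 \<or> y = m + 1")
    case False
    have "(3::nat) ^ x = 3 * 3 ^ (x - 1)" using step.hyps(1) by (cases x) auto
    moreover have "y - 1 \<le> m + 1" "1 \<le> y" "y \<le> m" using False step.prems by auto
    ultimately show ?thesis
      using step.prems step.hyps step.IH[of "y - 1"] step.IH[of y] step.IH[of "y + 1"]
      by (simp add: table_next_column)
  qed auto
qed

text \<open>As long as no path can have met the boundary, there are three choices for every step
  backwards.\<close>

lemma table_interior: "1 \<le> x \<Longrightarrow> x \<le> y \<Longrightarrow> x + y \<le> m + 1 \<Longrightarrow> table m x y = 3 ^ (x - 1)"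
proof (induction x arbitrary: y rule: dec_induct)
  case base
  then show ?case using table_first_column[of y m] by simp
next
  case (step x)
  have "(3::nat) ^ x = 3 * 3 ^ (x - 1)" using step.hyps(1) by (cases x) auto
  then show ?case
    using step.prems step.hyps step.IH[of "y - 1"] step.IH[of y] step.IH[of "y + 1"]
    by (simp add: table_next_column)
qed

lemma table_near_boundary: "1 \<le> x \<Longrightarrow> y < x \<Longrightarrow> y \<le> m + 1 \<Longrightarrow> table m x y < 3 ^ (x - 1)"
proof (induction x arbitrary: y rule: dec_induct)
  case base
  then show ?case by simp
next
  case (step x)
  show ?case
  proof (cases "y = 0 \<or> y = m + 1")
    case False
    have "(3::nat) ^ x = 3 * 3 ^ (x - 1)" using step.hyps(1) by (cases x) auto
    moreover have "y - 1 < x" "y - 1 \<le> m + 1" "1 \<le> y" "y \<le> m" using False step.prems step.hyps by auto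
    ultimately show ?thesis
      using step.prems step.hyps step.IH[of "y - 1"]
        table_le[of x y m] table_le[of x "y + 1" m]
      by (simp add: table_next_column)
  qed auto
qed

text \<open>A linear relation among the first \<open>k\<close> reduced columns propagates to the right: by symmetry it
  extends from the upper half to all rows, and every column is a linear function of the previous one.\<close>

lemma relation_propagates:
  fixes c :: "nat \<Rightarrow> real"
  assumes rel: "\<And>i. 1 \<le> i \<Longrightarrow> i \<le> half m \<Longrightarrow> (\<Sum>j<k. c j * real (table m (1 + j) i)) = 0"
    and "1 \<le> n" "i \<le> m + 1"
  shows "(\<Sum>j<k. c j * real (table m (n + j) i)) = 0"
  using assms(2,3)
proof (induction n arbitrary: i rule: dec_induct)
  case base
  consider "i = 0" | "1 \<le> i" "i \<le> half m" | "1 \<le> m + 1 - i" "m + 1 - i \<le> half m" | "i = m + 1"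
    using base unfolding half_eq by linarith
  then show ?case
  proof cases
    case 2
    then show ?thesis by (rule rel)
  next
    case 3
    then show ?thesis using rel[OF 3] base table_symmetric[of _ i m] by simp
  qed auto
next
  case (step n)
  show ?case
  proof (cases "i = 0 \<or> i = m + 1")
    case False
    then have "1 \<le> i" "i \<le> m" using step.prems by auto
    then have "(\<Sum>j<k. c j * real (table m (Suc n + j) i)) =
        (\<Sum>j<k. c j * real (table m (n + j) (i - 1))) + (\<Sum>j<k. c j * real (table m (n + j) i))
        + (\<Sum>j<k. c j * real (table m (n + j) (i + 1)))"
      using step.hyps by (simp add: table_next_column sum.distrib algebra_simps)
    also have "\<dots> = 0"
      using step.IH[of "i - 1"] step.IH[of i] step.IH[of "i + 1"] \<open>1 \<le> i\<close> \<open>i \<le> m\<close> by simp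
    finally show ?thesis .
  qed auto
qed

text \<open>The independence is visible in the middle row alone: its entries are \<open>1, 3, 9, \<dots>\<close> up to
  column \<open>k\<close> and break this pattern in column \<open>k + 1\<close>.  A relation, read at offset \<open>1\<close>, has \<open>3\<close> as
  a characteristic root; read at the offset that puts its last nonzero coefficient onto column
  \<open>k + 1\<close>, it then forces this coefficient to vanish.\<close>

lemma columns_independent:
  fixes c :: "nat \<Rightarrow> real"
  assumes m: "1 \<le> m" and k: "k = half m"
    and rel: "\<And>i. 1 \<le> i \<Longrightarrow> i \<le> k \<Longrightarrow> (\<Sum>j<k. c j * real (table m (1 + j) i)) = 0"
    and "r < k"
  shows "c r = 0"
proof -
  let ?s = "\<lambda>n. real (table m n k)"
  have k1: "1 \<le> k" "k \<le> m" "2 * k \<le> m + 1" using m unfolding k half_eq by auto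
  have all: "(\<Sum>j<k. c j * ?s (n + j)) = 0" if "1 \<le> n" for n
    using relation_propagates[where m = m and c = c and k = k and i = k, OF _ that] rel k k1 by simp
  have geo: "?s (1 + j) = 3 ^ j" if "j < k" for j
    using table_interior[of "1 + j" k m] that k1 by simp
  have root: "(\<Sum>j<k. c j * 3 ^ j) = 0"
    using all[of 1] geo by simp
  have break: "?s (k + 1) \<noteq> 3 ^ k"
  proof -
    have "table m (k + 1) k < 3 ^ k"
      using table_near_boundary[of "k + 1" k m] k1 by simp
    then show ?thesis
      by (metis of_nat_eq_iff of_nat_numeral of_nat_power nat_neq_iff)
  qed
  show ?thesis using \<open>r < k\<close>
  proof (induction "k - r" arbitrary: r rule: less_induct)
    case less
    have zero: "c j = 0" if "r < j" "j < k" for j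
      using less.hyps[of j] that by simp
    have "(\<Sum>j<k. c j * 3 ^ (k - r + j)) = 3 ^ (k - r) * (\<Sum>j<k. c j * 3 ^ j)"
      by (simp add: power_add sum_distrib_left ac_simps)
    then have "0 = (\<Sum>j<k. c j * (?s (k + 1 - r + j) - 3 ^ (k - r + j)))"
      using all[of "k + 1 - r"] root less.prems
      unfolding right_diff_distrib sum_subtractf by simp
    also have "\<dots> = (\<Sum>j\<in>{r}. c j * (?s (k + 1 - r + j) - 3 ^ (k - r + j)))"
    proof (rule sum.mono_neutral_right)
      show "\<forall>j\<in>{..<k} - {r}. c j * (?s (k + 1 - r + j) - 3 ^ (k - r + j)) = 0"
      proof
        fix j assume j: "j \<in> {..<k} - {r}"
        show "c j * (?s (k + 1 - r + j) - 3 ^ (k - r + j)) = 0"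
        proof (cases "r < j")
          case True
          then show ?thesis using zero j by simp
        next
          case False
          then have "k - r + j < k" "k + 1 - r + j = 1 + (k - r + j)" using j less.prems by auto
          then show ?thesis using geo[of "k - r + j"] by simp
        qed
      qed
    qed (use less.prems in auto)
    also have "\<dots> = c r * (?s (k + 1) - 3 ^ k)" using less.prems by simp
    finally show ?case using break by simp
  qed
qed

section \<open>Polynomials in the difference operator as recurrences\<close>

lemma apply_poly_eq_sum:
  "degree p \<le> N \<Longrightarrow> apply_poly p a n = (\<Sum>i\<le>N. coeff p i * (difference ^^ i) a n)"
  unfolding apply_poly_def
  by (rule sum.mono_neutral_left) (auto simp: coeff_eq_0)

lemma apply_poly_diff: "apply_poly (p - q) a n = apply_poly p a n - apply_poly q a n"
proof -
  let ?N = "max (degree p) (degree q)"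
  have "degree (p - q) \<le> ?N" by (rule degree_diff_le_max)
  then show ?thesis
    by (simp add: apply_poly_eq_sum[of _ ?N] left_diff_distrib sum_subtractf)
qed

lemma apply_poly_add: "apply_poly (p + q) a n = apply_poly p a n + apply_poly q a n"
proof -
  let ?N = "max (degree p) (degree q)"
  have "degree (p + q) \<le> ?N" by (rule degree_add_le_max)
  then show ?thesis
    by (simp add: apply_poly_eq_sum[of _ ?N] distrib_right sum.distrib)
qed

lemma apply_poly_const: "apply_poly [:c:] a n = c * a n"
  by (simp add: apply_poly_def)

lemma apply_poly_X_mult:
  "apply_poly ([:0, 1:] * p) a n = apply_poly p a (n + 1) - apply_poly p a n"
proof -
  have "degree ([:0, 1:] * p) \<le> Suc (degree p)" by (simp add: degree_pCons_le)
  then have "apply_poly ([:0, 1:] * p) a n =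
      (\<Sum>i\<le>Suc (degree p). coeff ([:0, 1:] * p) i * (difference ^^ i) a n)"
    by (rule apply_poly_eq_sum)
  also have "\<dots> = (\<Sum>i\<le>degree p. coeff p i * (difference ^^ Suc i) a n)"
    by (simp add: sum.atMost_Suc_shift del: funpow.simps sum.atMost_Suc)
  also have "\<dots> = apply_poly p a (n + 1) - apply_poly p a n"
    by (simp add: apply_poly_def difference_def right_diff_distrib sum_subtractf)
  finally show ?thesis .
qed

text \<open>Substituting \<open>\<Delta> = E - 1\<close>, where \<open>E\<close> is the shift, turns the operator into a recurrence.\<close>

lemma apply_poly_shift:
  "apply_poly p a n = (\<Sum>i\<le>degree p. coeff (pcompose p [:-1, 1:]) i * a (n + i))"
proof -
  have "apply_poly p a n = (\<Sum>i\<le>N. coeff (pcompose p [:-1, 1:]) i * a (n + i))"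
    if "degree p \<le> N" for N
    using that
  proof (induction p arbitrary: n N)
    case 0
    then show ?case by (simp add: apply_poly_def)
  next
    case (pCons c p)
    let ?q = "pcompose p [:-1, 1:]"
    have dq: "degree ?q = degree p" by (simp add: degree_pcompose)
    have split: "pCons c p = [:c:] + [:0, 1:] * p" by simp
    have q: "pcompose (pCons c p) [:-1, 1:] = [:c:] + pCons 0 ?q - ?q"
      by (simp add: pcompose_pCons)
    have expand: "(\<Sum>i\<le>N. coeff ?q i * a (l + i)) = apply_poly p a l" if "degree p \<le> N" for l N
      using pCons.IH[OF that] by simp
    have N: "degree p \<le> N"
      using pCons.prems by (cases "p = 0") auto
    have "(\<Sum>i\<le>N. coeff ([:c:]) i * a (n + i)) = c * a n"
      by (simp add: coeff_pCons sum.atMost_shift)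
    moreover have "(\<Sum>i\<le>N. coeff (pCons 0 ?q) i * a (n + i)) = apply_poly p a (n + 1)"
    proof (cases "p = 0")
      case True
      then show ?thesis by (simp add: apply_poly_def)
    next
      case False
      then obtain N' where N': "N = Suc N'" "degree p \<le> N'"
        using pCons.prems by (cases N) auto
      then show ?thesis
        using expand[of N' "n + 1"] by (simp add: sum.atMost_Suc_shift del: sum.atMost_Suc)
    qed
    moreover have "(\<Sum>i\<le>N. coeff ?q i * a (n + i)) = apply_poly p a n"
      by (rule expand[OF N])
    ultimately have "(\<Sum>i\<le>N. coeff (pcompose (pCons c p) [:-1, 1:]) i * a (n + i)) =
        c * a n + apply_poly p a (n + 1) - apply_poly p a n"
      unfolding q by (simp only: coeff_add coeff_diff distrib_right left_diff_distrib
          sum.distrib sum_subtractf)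
    then show ?case
      unfolding split by (simp only: apply_poly_add apply_poly_const apply_poly_X_mult)
  qed
  then show ?thesis by blast
qed

lemma apply_poly_cong:
  "(\<And>l. n \<le> l \<Longrightarrow> a l = b l) \<Longrightarrow> apply_poly p a n = apply_poly p b n"
  by (simp add: apply_poly_shift)

lemma apply_poly_commute:
  "apply_poly p (apply_poly q a) n = apply_poly q (apply_poly p a) n"
  unfolding apply_poly_shift sum_distrib_left
  by (subst sum.swap) (simp add: ac_simps)

lemma apply_poly_scale: "apply_poly p (\<lambda>n. c * a n) n = c * apply_poly p a n"
  unfolding apply_poly_shift sum_distrib_left by (simp add: ac_simps)

lemma monic_apply_poly:
  assumes "lead_coeff p = 1"
  shows "apply_poly p a n =
    a (n + degree p) - (\<Sum>j<degree p. - coeff (pcompose p [:-1, 1:]) j * a (n + j))"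
proof -
  have "coeff (pcompose p [:-1, 1:]) (degree p) = 1"
    using lead_coeff_comp[of "[:-1, 1:]" p] assms by (simp add: degree_pcompose)
  then show ?thesis
    by (simp add: apply_poly_shift lessThan_Suc_atMost[symmetric] sum_negf)
qed

section \<open>The multipliers annihilate the table\<close>

lemma degree_lead_coeff_multiplier:
  "degree (multiplier m (Suc n)) = Suc n \<and> lead_coeff (multiplier m (Suc n)) = 1"
proof (induction n rule: less_induct)
  case (less n)
  have two: "(2 :: real poly) = [:2:]" by (simp add: numeral_poly)
  consider "n = 0" | l where "n = Suc l" by (cases n) auto
  then show ?case
  proof cases
    case 1
    then show ?thesis by (simp add: two one_pCons)
  next
    case (2 l)
    have IH: "degree (multiplier m (Suc l)) = Suc l" "lead_coeff (multiplier m (Suc l)) = 1"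
      using less.IH[of l] 2 by auto
    have small: "degree (multiplier m l) < Suc (Suc l)"
    proof (cases l)
      case 0
      then show ?thesis by (simp add: two)
    next
      case (Suc l')
      then show ?thesis using less.IH[of l'] 2 by simp
    qed
    have X: "degree ([:0, 1:] * multiplier m (Suc l)) = Suc (Suc l)"
      "lead_coeff ([:0, 1:] * multiplier m (Suc l)) = 1"
      using IH by (auto simp: degree_pCons_eq_if)
    then have "degree (multiplier m (Suc n)) = Suc (Suc l)"
      unfolding 2 multiplier.simps(3)
      using small by (metis add_uminus_conv_diff degree_add_eq_left degree_minus)
    moreover have "coeff (multiplier m (Suc n)) (Suc (Suc l)) = 1"
      using X small unfolding 2 multiplier.simps(3) by (simp add: coeff_eq_0)
    ultimately show ?thesis by (simp add: 2)
  qed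
qed

text \<open>Applied to the middle row, the \<open>j\<close>-th multiplier moves \<open>j\<close> rows up, up to a constant factor.  The two initial values
  of the multipliers encode the reflection of row \<open>k + 1\<close>: it equals row \<open>k - 1\<close> for odd \<open>m\<close> and
  row \<open>k\<close> for even \<open>m\<close>.\<close>

lemma multiplier_middle_row:
  assumes m: "1 \<le> m" and k: "k = half m"
    and "1 \<le> n" "j \<le> k"
  shows "apply_poly (multiplier m j) (\<lambda>n. real (table m n k)) n =
    (if odd m then 2 else 1) * real (table m n (k - j))"
proof -
  define e :: real where "e = (if odd m then 2 else 1)"
  let ?C = "\<lambda>i n. real (table m n i)"
  have k1: "1 \<le> k" "k \<le> m" using m unfolding k half_eq by auto
  have step: "?C i (n + 1) - ?C i n = ?C (i - 1) n + ?C (i + 1) n"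
    if "1 \<le> n" "1 \<le> i" "i \<le> m" for i n
    using that by (simp add: table_next_column)
  have M0: "multiplier m 0 = [:e:]"
    by (simp add: e_def numeral_poly one_pCons)
  have M1: "multiplier m (Suc 0) = [:0, 1:] * [:1:] - [:2 - e:]"
    by (simp add: e_def numeral_poly one_pCons)
  have refl: "?C (k + 1) n = (if odd m then ?C (k - 1) n else ?C k n)" if "1 \<le> n" for n
  proof -
    have "m + 1 - (k + 1) = (if odd m then k - 1 else k)"
      unfolding k half_eq by (auto elim!: oddE evenE)
    then show ?thesis
      using table_symmetric[of n "k + 1" m] that k1 by (auto split: if_splits)
  qed
  have "\<forall>n\<ge>1. apply_poly (multiplier m j) (?C k) n = e * ?C (k - j) n"
    using \<open>j \<le> k\<close>
  proof (induction j rule: less_induct)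
    case (less j)
    consider "j = 0" | "j = 1" | l where "j = Suc (Suc l)"
      by (metis One_nat_def not0_implies_Suc)
    then show ?case
    proof cases
      case 1
      then show ?thesis unfolding 1 M0 by (simp add: apply_poly_const)
    next
      case 2
      have "apply_poly (multiplier m (Suc 0)) (?C k) n = e * ?C (k - 1) n" if "1 \<le> n" for n
        using step[OF that, of k] refl[OF that] k1
        unfolding M1 apply_poly_diff apply_poly_X_mult apply_poly_const
        by (simp add: e_def split: if_splits)
      then show ?thesis by (simp add: 2)
    next
      case (3 l)
      have "apply_poly (multiplier m j) (?C k) n = e * ?C (k - j) n" if "1 \<le> n" for n
      proof -
        have "apply_poly (multiplier m j) (?C k) n =
            e * (?C (k - Suc l) (n + 1) - ?C (k - Suc l) n) - e * ?C (k - l) n"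
          unfolding 3 multiplier.simps(3) apply_poly_diff apply_poly_X_mult
          using less.IH[of l] less.IH[of "Suc l"] less.prems 3 that
          by (simp add: right_diff_distrib)
        also have "\<dots> = e * ?C (k - j) n"
        proof -
          have "k - Suc l - 1 = k - j" "k - Suc l + 1 = k - l" "1 \<le> k - Suc l" "k - Suc l \<le> m"
            using 3 less.prems k1 by auto
          then show ?thesis
            using step[OF that, of "k - Suc l"] by (simp add: algebra_simps)
        qed
        finally show ?thesis .
      qed
      then show ?thesis by blast
    qed
  qed
  then show ?thesis using \<open>1 \<le> n\<close> by (simp add: e_def)
qed

lemma multiplier_annihilates_table:
  assumes m: "1 \<le> m" and k: "k = half m"
    and n: "1 \<le> n" and i: "1 \<le> i" "i \<le> m"
  shows "apply_poly (multiplier m k) (\<lambda>n. real (table m n i)) n = 0"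
proof -
  let ?C = "\<lambda>i n. real (table m n i)"
  have upper: "apply_poly (multiplier m k) (?C i) n = 0" if "i \<le> k" for i
  proof -
    define e :: real where "e = (if odd m then 2 else 1)"
    have "e * apply_poly (multiplier m k) (?C i) n =
        apply_poly (multiplier m k) (\<lambda>n. e * ?C i n) n"
      by (simp add: apply_poly_scale)
    also have "\<dots> = apply_poly (multiplier m k) (apply_poly (multiplier m (k - i)) (?C k)) n"
      using multiplier_middle_row[OF m k, of _ "k - i"] that n
      by (intro apply_poly_cong) (simp add: e_def)
    also have "\<dots> = apply_poly (multiplier m (k - i)) (apply_poly (multiplier m k) (?C k)) n"
      by (rule apply_poly_commute)
    also have "\<dots> = apply_poly (multiplier m (k - i)) (\<lambda>_. 0) n"
      using multiplier_middle_row[OF m k, of _ k] n by (intro apply_poly_cong) simp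
    also have "\<dots> = 0" by (simp add: apply_poly_shift)
    finally show ?thesis by (simp add: e_def split: if_splits)
  qed
  show ?thesis
  proof (cases "i \<le> k")
    case False
    then have "m + 1 - i \<le> k" unfolding k half_eq by linarith
    then have "apply_poly (multiplier m k) (?C (m + 1 - i)) n = 0" by (rule upper)
    moreover have "apply_poly (multiplier m k) (?C (m + 1 - i)) n =
        apply_poly (multiplier m k) (?C i) n"
      using n i table_symmetric[of _ i m] by (intro apply_poly_cong) simp
    ultimately show ?thesis by simp
  qed (rule upper)
qed

section \<open>The determinant is a multiplier\<close>

text \<open>Only the first row and column need to have tridiagonal shape.\<close>

lemma det_tridiagonal_step:
  fixes A :: "'a :: comm_ring_1 mat"
  assumes A: "A \<in> carrier_mat (Suc (Suc n)) (Suc (Suc n))"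
    and row: "\<And>j. 2 \<le> j \<Longrightarrow> j < Suc (Suc n) \<Longrightarrow> A $$ (0, j) = 0"
    and col: "\<And>i. 2 \<le> i \<Longrightarrow> i < Suc (Suc n) \<Longrightarrow> A $$ (i, 0) = 0"
  shows "det A = A $$ (0, 0) * det (mat_delete A 0 0)
    - A $$ (0, 1) * A $$ (1, 0) * det (mat_delete (mat_delete A 0 0) 0 0)"
proof -
  let ?B = "mat_delete A 0 1"
  have B: "?B \<in> carrier_mat (Suc n) (Suc n)"
    using A by (auto simp: mat_delete_def)
  have "det A = (\<Sum>j<Suc (Suc n). A $$ (0, j) * cofactor A 0 j)"
    by (rule laplace_expansion_row[OF A]) simp
  also have "\<dots> = A $$ (0, 0) * cofactor A 0 0 + A $$ (0, 1) * cofactor A 0 1"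
    using row by (simp add: sum.lessThan_Suc_shift del: sum.lessThan_Suc)
  finally have 1: "det A = A $$ (0, 0) * det (mat_delete A 0 0) - A $$ (0, 1) * det ?B"
    by (simp add: cofactor_def)
  have "det ?B = (\<Sum>i<Suc n. ?B $$ (i, 0) * cofactor ?B i 0)"
    by (rule laplace_expansion_column[OF B]) simp
  also have "\<dots> = ?B $$ (0, 0) * cofactor ?B 0 0"
  proof -
    have "?B $$ (Suc i, 0) = 0" if "i < n" for i
      using A that col[of "Suc (Suc i)"] by (simp add: mat_delete_def)
    then show ?thesis
      by (simp add: sum.lessThan_Suc_shift del: sum.lessThan_Suc)
  qed
  also have "?B $$ (0, 0) = A $$ (1, 0)"
    using A by (simp add: mat_delete_def)
  also have "cofactor ?B 0 0 = det (mat_delete (mat_delete A 0 0) 0 0)"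
  proof -
    have "mat_delete ?B 0 0 = mat_delete (mat_delete A 0 0) 0 0"
      using A by (intro eq_matI) (auto simp: mat_delete_def)
    then show ?thesis by (simp add: cofactor_def)
  qed
  finally show ?thesis using 1 by (simp add: mult.assoc)
qed

text \<open>The matrix \<open>(\<Delta> + 1) I - T\<close> for the \<open>k \<times> k\<close> reduced matrix \<open>T\<close> of either kind.\<close>

definition char_matrix :: "bool \<Rightarrow> nat \<Rightarrow> real poly mat" where
  "char_matrix odd_kind k = [:1, 1:] \<cdot>\<^sub>m 1\<^sub>m k
     - map_mat (\<lambda>c. [:c:]) (if odd_kind then odd_matrix k else even_matrix k)"

lemma char_matrix_carrier: "char_matrix b k \<in> carrier_mat k k"
  by (auto simp: char_matrix_def odd_matrix_def even_matrix_def)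

text \<open>The exceptional entry lies in the last row, so it survives the removal of the first row and
  column, except that for \<open>k = 1\<close> the exceptional entry \<open>(2, 1)\<close> of the odd kind is removed with the
  first column; the \<open>1 \<times> 1\<close> matrix of that kind has none either.\<close>

lemma mat_delete_char_matrix:
  assumes "1 \<le> k"
  shows "mat_delete (char_matrix b (Suc k)) 0 0 = char_matrix b k"
  using assms
  by (intro eq_matI) (auto simp: mat_delete_def char_matrix_def odd_matrix_def even_matrix_def)

lemma det_char_matrix: "det (char_matrix (odd m) (Suc n)) = multiplier m (Suc n)"
proof (induction n rule: less_induct)
  case (less n)
  have two: "(2 :: real poly) = [:2:]" by (simp add: numeral_poly)
  consider "n = 0" | "n = 1" | l where "n = Suc (Suc l)"
    by (metis One_nat_def not0_implies_Suc)
  then show ?case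
  proof cases
    case 1
    have "det (char_matrix (odd m) 1) = char_matrix (odd m) 1 $$ (0, 0)"
      by (rule det_single[OF char_matrix_carrier])
    also have "\<dots> = multiplier m 1"
      by (simp add: char_matrix_def odd_matrix_def even_matrix_def two one_pCons)
    finally show ?thesis by (simp add: 1)
  next
    case 2
    let ?A = "char_matrix (odd m) (Suc (Suc 0))"
    have "mat_delete ?A 0 0 = char_matrix (odd m) (Suc 0)"
      by (rule mat_delete_char_matrix) simp
    moreover have "det (mat_delete (mat_delete ?A 0 0) 0 0) = 1"
      by (rule det_dim_zero) (simp add: mat_delete_def char_matrix_def odd_matrix_def even_matrix_def)
    moreover have "det ?A = ?A $$ (0, 0) * det (mat_delete ?A 0 0)
        - ?A $$ (0, 1) * ?A $$ (1, 0) * det (mat_delete (mat_delete ?A 0 0) 0 0)"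
      by (rule det_tridiagonal_step[OF char_matrix_carrier]) auto
    moreover have "?A $$ (0, 0) = [:0, 1:]" "?A $$ (0, 1) * ?A $$ (1, 0) = multiplier m 0"
      by (auto simp: char_matrix_def odd_matrix_def even_matrix_def two one_pCons)
    ultimately show ?thesis
      using less.IH[of 0] 2 by simp
  next
    case (3 l)
    let ?A = "char_matrix (odd m) (Suc (Suc (Suc l)))"
    have "mat_delete ?A 0 0 = char_matrix (odd m) (Suc (Suc l))"
      by (rule mat_delete_char_matrix) simp
    moreover have "mat_delete (char_matrix (odd m) (Suc (Suc l))) 0 0 = char_matrix (odd m) (Suc l)"
      by (rule mat_delete_char_matrix) simp
    moreover have "det ?A = ?A $$ (0, 0) * det (mat_delete ?A 0 0)
        - ?A $$ (0, 1) * ?A $$ (1, 0) * det (mat_delete (mat_delete ?A 0 0) 0 0)"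
      by (rule det_tridiagonal_step[OF char_matrix_carrier])
        (auto simp: char_matrix_def odd_matrix_def even_matrix_def)
    moreover have "?A $$ (0, 0) = [:0, 1:]" "?A $$ (0, 1) = -1" "?A $$ (1, 0) = -1"
      by (auto simp: char_matrix_def odd_matrix_def even_matrix_def one_pCons)
    ultimately show ?thesis
      using less.IH[of l] less.IH[of "Suc l"] 3 by simp
  qed
qed

lemma det_poly_eq_multiplier:
  assumes "1 \<le> m"
  shows "det_poly m = multiplier m (half m)"
proof -
  obtain n where n: "half m = Suc n"
    using assms unfolding half_eq by (cases "(m + 1) div 2") auto
  then have "det_poly m = det (char_matrix (odd m) (Suc n))"
    unfolding det_poly_def char_matrix_def reduced_matrix_def by simp
  then show ?thesis by (simp add: det_char_matrix n)
qed

section \<open>The solution of the linear system\<close>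

lemma column_solution_iff:
  assumes "k = half m"
  shows "column_solution m \<alpha> \<longleftrightarrow> dim_vec \<alpha> = k \<and>
    (\<forall>i. 1 \<le> i \<and> i \<le> k \<longrightarrow> (\<Sum>j<k. \<alpha> $ j * real (table m (1 + j) i)) = real (table m (k + 1) i))"
proof -
  have entry: "(reduced_columns m *\<^sub>v \<alpha>) $ i = (\<Sum>j<k. \<alpha> $ j * real (table m (1 + j) (i + 1)))"
    if "dim_vec \<alpha> = k" "i < k" for i
    using that unfolding assms
    by (simp add: reduced_columns_def reduced_column_def mat_of_cols_def scalar_prod_def
        atLeast0LessThan mult.commute del: upt_Suc)
  have dim: "dim_vec (reduced_columns m *\<^sub>v \<alpha>) = k"
    unfolding assms by (simp add: reduced_columns_def)
  have dim_col: "dim_vec (reduced_column m (k + 1)) = k"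
    unfolding assms by (simp add: reduced_column_def)
  have col: "reduced_column m (k + 1) $ i = real (table m (k + 1) (i + 1))" if "i < k" for i
    using that unfolding assms by (simp add: reduced_column_def)
  have "reduced_columns m *\<^sub>v \<alpha> = reduced_column m (k + 1) \<longleftrightarrow>
      (\<forall>i<k. (\<Sum>j<k. \<alpha> $ j * real (table m (1 + j) (i + 1))) = real (table m (k + 1) (i + 1)))"
    if "dim_vec \<alpha> = k"
    by (simp only: vec_eq_iff dim dim_col entry[OF that] col simp_thms cong: imp_cong)
  then have sol: "column_solution m \<alpha> \<longleftrightarrow> dim_vec \<alpha> = k \<and>
      (\<forall>i<k. (\<Sum>j<k. \<alpha> $ j * real (table m (1 + j) (i + 1))) = real (table m (k + 1) (i + 1)))"
    unfolding column_solution_def carrier_vec_def mem_Collect_eq assms[symmetric] by blast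
  have shift: "(\<forall>i. 1 \<le> i \<and> i \<le> k \<longrightarrow> P i) \<longleftrightarrow> (\<forall>i<k. P (i + 1))"
    for P :: "nat \<Rightarrow> bool"
  proof (intro iffI allI impI)
    fix i assume P: "\<forall>i<k. P (i + 1)" and i: "1 \<le> i \<and> i \<le> k"
    then have "i - 1 < k" by linarith
    then have "P (i - 1 + 1)" using P by blast
    then show "P i" using i by simp
  qed simp
  show ?thesis unfolding shift by (rule sol)
qed

theorem corollary2p10:
  fixes m k :: nat
  assumes "m \<ge> 1"
    and "k = nat \<lceil>real m / 2\<rceil>"
  shows "(\<exists>!\<alpha>. column_solution m \<alpha>) \<and>
    (\<forall>\<alpha>. column_solution m \<alpha> \<longrightarrow>
      \<comment> \<open>the recurrence relations\<close>
      (\<forall>i\<in>{1..m}. \<forall>n\<ge>1.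
         real (table m (n + k) i) = (\<Sum>j<k. \<alpha> $ j * real (table m (n + j) i))) \<and>
      (\<forall>n\<ge>1. real (column_sum m (n + k)) = (\<Sum>j<k. \<alpha> $ j * real (column_sum m (n + j)))) \<and>
      \<comment> \<open>the operator formulas\<close>
      (\<forall>i\<in>{1..m}. \<forall>n\<ge>1.
         apply_poly (det_poly m) (\<lambda>n. real (table m n i)) n = 0 \<and>
         apply_poly (multiplier m k) (\<lambda>n. real (table m n i)) n = 0) \<and>
      (\<forall>n\<ge>1.
         apply_poly (det_poly m) (\<lambda>n. real (column_sum m n)) n = 0 \<and>
         apply_poly (multiplier m k) (\<lambda>n. real (column_sum m n)) n = 0) \<and>
      \<comment> \<open>expanding either operator on a sequence gives exactly the recurrence with coefficients \<open>\<alpha>\<close>\<close>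
      (\<forall>a n.
         apply_poly (det_poly m) a n = a (n + k) - (\<Sum>j<k. \<alpha> $ j * a (n + j)) \<and>
         apply_poly (multiplier m k) a n = a (n + k) - (\<Sum>j<k. \<alpha> $ j * a (n + j))))"
proof -
  define M where "M = multiplier m k"
  define \<beta> where "\<beta> = vec k (\<lambda>j. - coeff (pcompose M [:-1, 1:]) j)"
  have k1: "1 \<le> k" "k \<le> m" using assms unfolding assms(2) half_eq by auto
  then obtain l where "k = Suc l" by (cases k) auto
  then have "degree M = k" "lead_coeff M = 1"
    using degree_lead_coeff_multiplier[of m l] by (auto simp: M_def)
  then have M: "apply_poly M a n = a (n + k) - (\<Sum>j<k. \<beta> $ j * a (n + j))" for a n
    using monic_apply_poly[of M a n] by (simp add: \<beta>_def)
  have det: "det_poly m = M"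
    using det_poly_eq_multiplier[OF assms(1)] by (simp add: M_def assms(2))
  have row: "apply_poly M (\<lambda>n. real (table m n i)) n = 0" if "1 \<le> n" "1 \<le> i" "i \<le> m" for i n
    using multiplier_annihilates_table[OF assms that] by (simp add: M_def)
  have rec: "real (table m (n + k) i) = (\<Sum>j<k. \<beta> $ j * real (table m (n + j) i))"
    if "1 \<le> n" "1 \<le> i" "i \<le> m" for i n
    using row[OF that] by (simp add: M)
  have sum_rec: "real (column_sum m (n + k)) = (\<Sum>j<k. \<beta> $ j * real (column_sum m (n + j)))"
    if "1 \<le> n" for n
    using rec[OF that] unfolding column_sum_def of_nat_sum sum_distrib_left
    by (subst sum.swap) simp
  have sol: "column_solution m \<beta>"
    unfolding column_solution_iff[OF assms(2)]
    using rec[of 1] k1 by (simp add: \<beta>_def add.commute)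
  have unique: "\<alpha> = \<beta>" if "column_solution m \<alpha>" for \<alpha>
  proof (rule eq_vecI)
    have \<alpha>: "dim_vec \<alpha> = k" "\<And>i. 1 \<le> i \<Longrightarrow> i \<le> k \<Longrightarrow>
        (\<Sum>j<k. \<alpha> $ j * real (table m (1 + j) i)) = real (table m (k + 1) i)"
      using that unfolding column_solution_iff[OF assms(2)] by blast+
    have \<beta>: "\<And>i. 1 \<le> i \<Longrightarrow> i \<le> k \<Longrightarrow>
        (\<Sum>j<k. \<beta> $ j * real (table m (1 + j) i)) = real (table m (k + 1) i)"
      using sol unfolding column_solution_iff[OF assms(2)] by blast
    show "dim_vec \<alpha> = dim_vec \<beta>" using \<alpha> by (simp add: \<beta>_def)
    fix r assume "r < dim_vec \<beta>"
    then have "r < k" by (simp add: \<beta>_def)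
    then have "\<alpha> $ r - \<beta> $ r = 0"
      using columns_independent[OF assms, of "\<lambda>j. \<alpha> $ j - \<beta> $ j" r] \<alpha>(2) \<beta>
      by (simp add: left_diff_distrib sum_subtractf)
    then show "\<alpha> $ r = \<beta> $ r" by simp
  qed
  have "\<exists>!\<alpha>. column_solution m \<alpha>" using sol unique by blast
  moreover have "\<forall>n\<ge>1. apply_poly M (\<lambda>n. real (column_sum m n)) n = 0"
    using sum_rec by (simp add: M)
  ultimately show ?thesis
    using unique rec sum_rec row M unfolding det M_def[symmetric] by auto
qed

end
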